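(* Assume that $w(u) = 1$ if $u \leq q$ and $w(u)=0$ otherwise, for some $q \in (0,1)$. Let $k \in \mathbb{N}$, $(\theta_k, \theta_{k+1}) \in \Theta^2$ and $\Delta_k\in\mathbb{R}$ be such that $J(\theta_{k+1} | \theta_k ) \geq \exp(\Delta_k) Z_w$ with $\exp(\Delta_k)\, \mathbb{P}_{X \sim p_{\theta_{k+1}}}[f(X) \leq Q_{\theta_{k+1}}^q(f)] \in [0,1]$. Write $F_{\theta_{k+1}}: u \longmapsto \mathbb{P}_{X \sim p_{\theta_{k+1}}}[f(X) \leq u]$. (a) Suppose that $F_{\theta_{k+1}}$ is continuous and strictly monotonic, and hence bijective from the range of $f$ (which is thus an interval of $\mathbb{R}$) to $[0,1]$. Then $$Q_{\theta_k}^q(f) \geq F_{\theta_{k+1}}^{-1}\left(\exp(\Delta_k)\, F_{\theta_{k+1}}(Q_{\theta_{k+1}}^q(f))\right).$$ (b) If $F_{\theta_{k+1}}$ is bijective and $\mathcal{C}^1$ in a neighbourhood of $Q_{\theta_{k+1}}^q(f)$ with $F_{\theta_{k+1}}'(Q_{\theta_{k+1}}^q(f)) \neq 0$, then $$Q_{\theta_k}^q(f) \geq Q_{\theta_{k+1}}^q(f) + q\, \Delta_k \left(F_{\theta_{k+1}}^{-1}\right)'(q) + o(\Delta_k^2)$$ for $\Delta_k$ small enough, with $\left(F_{\theta_{k+1}}^{-1}\right)'(q) > 0$.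
   Context: Setting: $\mathbb{X}$ is a measurable space with a measure $m$, $f:\mathbb{X}\to\mathbb{R}$ is an objective function, and $\{p_\theta,\ \theta\in\Theta\}$ is a parametric family of probability distributions on $\mathbb{X}$, each having a density with respect to $m$, also denoted $p_\theta$. For $\theta\in\Theta$ and $x\in\mathbb{X}$, set $q_\theta^{<}(x) = \mathbb{P}_{X\sim p_\theta}[f(X)<f(x)]$ and $q_\theta^{\leq}(x) = \mathbb{P}_{X\sim p_\theta}[f(X)\leq f(x)]$. Weighting: for $w:[0,1]\to\mathbb{R}_+$ non-increasing, $Z_w=\int_0^1 w(u)\,du$, and the preference function $W_\theta^f:\mathbb{X}\to\mathbb{R}$ is $W_\theta^f(x) = w(q_\theta^{\leq}(x))$ if $q_\theta^{\leq}(x)=q_\theta^{<}(x)$, and $W_\theta^f(x) = \frac{1}{q_\theta^{\leq}(x)-q_\theta^{<}(x)}\int_{q_\theta^{<}(x)}^{q_\theta^{\leq}(x)} w(u)\,du$ otherwise. For the indicator weighting of the claim, $Z_w=q$. Reformulated objective: $J(\theta|\theta') = \mathbb{E}_{X\sim p_\theta}[W_{\theta'}^f(X)]$ for $\theta,\theta'\in\Theta$. Quantile: for $q\in(0,1)$, $Q_\theta^q(f)$ is the supremum of all $u\in\mathbb{R}$ such that both $\mathbb{P}_{X\sim p_\theta}[f(X)\leq u]\geq q$ and $\mathbb{P}_{X\sim p_\theta}[f(X)\geq u]\geq 1-q$. In (b), $F_{\theta_{k+1}}^{-1}$ denotes the inverse of $F_{\theta_{k+1}}$ near $Q_{\theta_{k+1}}^q(f)$,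 and $o(\Delta_k^2)$ is the usual Landau notation as $\Delta_k\to 0$.
   Formalization: In (b), the remainder o(Δ_k²) is proved only for fixed θ_k, θ_{k+1}; uniformly in θ_k it is false (e.g. when ln F_{θ_{k+1}} is strictly convex near the quantile), so the uniform expansion is stated with remainder o(Δ_k). *)

theory Defs
  imports "HOL-Probability.Probability" "HOL-Library.Landau_Symbols"
begin

text \<open>A distribution on the search space is a probability measure \<open>P\<close>; the notions below depend on the
  parameter of the family only through its distribution.\<close>

definition q_less :: "'x measure \<Rightarrow> ('x \<Rightarrow> real) \<Rightarrow> 'x \<Rightarrow> real" where
  "q_less P f x = \<P>(y in P. f y < f x)"

definition q_le :: "'x measure \<Rightarrow> ('x \<Rightarrow> real) \<Rightarrow> 'x \<Rightarrow> real" where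
  "q_le P f x = \<P>(y in P. f y \<le> f x)"

text \<open>Weightings \<open>w\<close> are functions on the unit interval; their values elsewhere are never used.\<close>

definition weight_mass :: "(real \<Rightarrow> real) \<Rightarrow> real" where
  "weight_mass w = (LBINT u:{0..1}. w u)"

definition preference :: "(real \<Rightarrow> real) \<Rightarrow> 'x measure \<Rightarrow> ('x \<Rightarrow> real) \<Rightarrow> 'x \<Rightarrow> real" where
  "preference w P f x =
     (if q_le P f x = q_less P f x then w (q_le P f x)
      else (LBINT u:{q_less P f x..q_le P f x}. w u) / (q_le P f x - q_less P f x))"

text \<open>\<open>J w f P P'\<close> is \<open>J(\<theta>|\<theta>')\<close>, where \<open>P\<close> and \<open>P'\<close> are the distributions of parameters
  \<open>\<theta>\<close> and \<open>\<theta>'\<close>.\<close>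

definition J :: "(real \<Rightarrow> real) \<Rightarrow> ('x \<Rightarrow> real) \<Rightarrow> 'x measure \<Rightarrow> 'x measure \<Rightarrow> real" where
  "J w f P P' = (\<integral>x. preference w P' f x \<partial>P)"

text \<open>For \<open>0 < q < 1\<close> the set below is nonempty and bounded, so the real supremum is meaningful.\<close>

definition quantile :: "'x measure \<Rightarrow> ('x \<Rightarrow> real) \<Rightarrow> real \<Rightarrow> real" where
  "quantile P f q = Sup {u. \<P>(x in P. f x \<le> u) \<ge> q \<and> \<P>(x in P. f x \<ge> u) \<ge> 1 - q}"

text \<open>The standing relation between the current distribution \<open>P\<close>, the next distribution \<open>P'\<close> and
  the gain \<open>\<Delta>\<close>.\<close>

definition gain_condition ::
    "(real \<Rightarrow> real) \<Rightarrow> ('x \<Rightarrow> real) \<Rightarrow> real \<Rightarrow> 'x measure \<Rightarrow> 'x measure \<Rightarrow> real \<Rightarrow> bool" where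
  "gain_condition w f q P P' \<Delta> \<longleftrightarrow>
     J w f P' P \<ge> exp \<Delta> * weight_mass w \<and>
     exp \<Delta> * \<P>(x in P'. f x \<le> quantile P' f q) \<in> {0..1}"

end

theory Submission
  imports Defs
begin

text \<open>
  For the weight \<open>w = 1\<^bsub>[0,q]\<^esub>\<close> the preference function satisfies \<open>W x \<le> 1\<close>
  if \<open>f x\<close> is at most the \<open>q\<close>-quantile \<open>Q\<close> of the current distribution, and \<open>W x = 0\<close> otherwise. Integrating
  against the next distribution gives \<open>J \<le> F Q\<close>, so the gain condition yields
  \<open>exp \<Delta> * q \<le> F Q\<close>, and both parts follow by inverting \<open>F\<close>. For a fixed pair of parameters the
  second-order remainder can even be taken to be \<open>0\<close>: if \<open>Q\<close> exceeds the next quantile then the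
  bound holds for all small \<open>\<Delta>\<close>, if they are equal then the gain condition forces \<open>\<Delta> \<le> 0\<close>, and if
  \<open>Q\<close> is smaller then the gain condition fails for all small \<open>\<Delta>\<close>.
\<close>

section \<open>Distribution function of \<open>f\<close>: monotonicity, one-sided limits and limits
  at infinity\<close>

lemma (in prob_space) real_distribution_distr_borel:
  assumes "f \<in> borel_measurable M"
  shows "real_distribution (distr M borel f)"
  using assms prob_space_distr unfolding real_distribution_def real_distribution_axioms_def by auto

text \<open>Links the probabilities in question to the \<open>cdf\<close> of the image measure of
  \<open>f\<close>, so that the limits below are instances of facts about
  \<open>real_distribution\<close>.\<close>

lemma (in prob_space) cdf_distr_eq_prob:
  assumes "f \<in> borel_measurable M"
  shows "cdf (distr M borel f) = (\<lambda>u. \<P>(x in M. f x \<le> u))"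
  using assms by (auto simp: cdf_def measure_distr fun_eq_iff intro!: arg_cong[where f=prob])

lemma (in prob_space) prob_ge_eq:
  fixes f :: "'a \<Rightarrow> real"
  assumes [measurable]: "f \<in> borel_measurable M"
  shows "\<P>(x in M. f x \<ge> u) = 1 - \<P>(x in M. f x < u)"
  using prob_neg[of "\<lambda>x. f x < u"] by (simp add: not_less)

lemma (in prob_space) prob_le_mono:
  fixes f :: "'a \<Rightarrow> real"
  assumes [measurable]: "f \<in> borel_measurable M" and "u \<le> v"
  shows "\<P>(x in M. f x \<le> u) \<le> \<P>(x in M. f x \<le> v)"
  using assms(2) by (intro finite_measure_mono) auto

lemma (in prob_space) prob_le_le_prob_less:
  fixes f :: "'a \<Rightarrow> real"
  assumes [measurable]: "f \<in> borel_measurable M" and "u < v"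
  shows "\<P>(x in M. f x \<le> u) \<le> \<P>(x in M. f x < v)"
  using assms(2) by (intro finite_measure_mono) auto

lemma (in prob_space) tendsto_prob_le_at_left:
  fixes f :: "'a \<Rightarrow> real"
  assumes f: "f \<in> borel_measurable M"
  shows "((\<lambda>u. \<P>(x in M. f x \<le> u)) \<longlongrightarrow> \<P>(x in M. f x < a)) (at_left a)"
proof -
  interpret D: real_distribution "distr M borel f"
    by (rule real_distribution_distr_borel[OF f])
  have "measure (distr M borel f) {..<a} = \<P>(x in M. f x < a)"
    using f by (auto simp: measure_distr intro!: arg_cong[where f=prob])
  with D.cdf_at_left[of a] show ?thesis
    by (simp add: cdf_distr_eq_prob[OF f])
qed

lemma (in prob_space) tendsto_prob_le_at_right:
  fixes f :: "'a \<Rightarrow> real"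
  assumes f: "f \<in> borel_measurable M"
  shows "((\<lambda>u. \<P>(x in M. f x \<le> u)) \<longlongrightarrow> \<P>(x in M. f x \<le> a)) (at_right a)"
proof -
  interpret D: real_distribution "distr M borel f"
    by (rule real_distribution_distr_borel[OF f])
  show ?thesis
    using D.cdf_is_right_cont[of a] by (simp add: cdf_distr_eq_prob[OF f] continuous_within)
qed

lemma (in prob_space) tendsto_prob_le_at_top:
  fixes f :: "'a \<Rightarrow> real"
  assumes f: "f \<in> borel_measurable M"
  shows "((\<lambda>u. \<P>(x in M. f x \<le> u)) \<longlongrightarrow> 1) at_top"
proof -
  interpret D: real_distribution "distr M borel f"
    by (rule real_distribution_distr_borel[OF f])
  show ?thesis
    using D.cdf_lim_at_top_prob by (simp add: cdf_distr_eq_prob[OF f])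
qed

lemma (in prob_space) tendsto_prob_le_at_bot:
  fixes f :: "'a \<Rightarrow> real"
  assumes f: "f \<in> borel_measurable M"
  shows "((\<lambda>u. \<P>(x in M. f x \<le> u)) \<longlongrightarrow> 0) at_bot"
proof -
  interpret D: real_distribution "distr M borel f"
    by (rule real_distribution_distr_borel[OF f])
  show ?thesis
    using D.cdf_lim_at_bot by (simp add: cdf_distr_eq_prob[OF f])
qed

section \<open>Quantiles: existence, attainment of the supremum, and behaviour beyond it\<close>

definition quantile_set :: "'x measure \<Rightarrow> ('x \<Rightarrow> real) \<Rightarrow> real \<Rightarrow> real set" where
  "quantile_set P f q = {u. \<P>(x in P. f x \<le> u) \<ge> q \<and> \<P>(x in P. f x \<ge> u) \<ge> 1 - q}"

lemma quantile_eq_Sup: "quantile P f q = Sup (quantile_set P f q)"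
  by (simp add: quantile_def quantile_set_def)

context prob_space
begin

context
  fixes f :: "'a \<Rightarrow> real" and q :: real
  assumes f [measurable]: "f \<in> borel_measurable M" and q: "q \<in> {0<..<1}"
begin

text \<open>Taking the complement in the second condition expresses both conditions through the
  distribution function and its left limit.\<close>

lemma mem_quantile_set_iff:
  "u \<in> quantile_set M f q \<longleftrightarrow> q \<le> \<P>(x in M. f x \<le> u) \<and> \<P>(x in M. f x < u) \<le> q"
  by (auto simp: quantile_set_def prob_ge_eq)

text \<open>The witness is the infimum \<open>a\<close> of the points where the distribution
  function has reached \<open>q\<close>: right continuity gives the first condition at
  \<open>a\<close>, and the left limit, taken along values below \<open>q\<close>, gives the
  second.\<close>

lemma quantile_set_nonempty: "quantile_set M f q \<noteq> {}"
proof -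
  define A where "A = {u. q \<le> \<P>(x in M. f x \<le> u)}"
  define a where "a = Inf A"
  have "\<forall>\<^sub>F u in at_top. q < \<P>(x in M. f x \<le> u)"
    using tendsto_prob_le_at_top[OF f] q by (intro order_tendstoD) auto
  then obtain u0 where "q < \<P>(x in M. f x \<le> u0)"
    by (auto simp: eventually_at_top_linorder)
  then have ne: "A \<noteq> {}" by (auto simp: A_def intro!: less_imp_le)
  have "\<forall>\<^sub>F u in at_bot. \<P>(x in M. f x \<le> u) < q"
    using tendsto_prob_le_at_bot[OF f] q by (intro order_tendstoD) auto
  then obtain u1 where u1: "\<And>u. u \<le> u1 \<Longrightarrow> \<P>(x in M. f x \<le> u) < q"
    by (auto simp: eventually_at_bot_linorder)
  have bdd: "bdd_below A"
  proof (rule bdd_belowI)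
    fix u assume "u \<in> A"
    then show "u1 \<le> u" using u1[of u] by (cases "u \<le> u1") (auto simp: A_def)
  qed
  have "q \<le> \<P>(x in M. f x \<le> a)"
  proof (rule tendsto_lowerbound[OF tendsto_prob_le_at_right[OF f]])
    have "q \<le> \<P>(x in M. f x \<le> u)" if au: "a < u" for u
    proof -
      obtain v where "v \<in> A" "v < u"
        using au cInf_lessD[OF ne, of u] by (auto simp: a_def)
      then show ?thesis using prob_le_mono[OF f, of v u] by (auto simp: A_def)
    qed
    then show "\<forall>\<^sub>F u in at_right a. q \<le> \<P>(x in M. f x \<le> u)"
      by (auto simp: eventually_at_filter)
  qed simp
  moreover have "\<P>(x in M. f x < a) \<le> q"
  proof (rule tendsto_upperbound[OF tendsto_prob_le_at_left[OF f]])
    have "\<P>(x in M. f x \<le> u) \<le> q" if "u < a" for u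
      using that cInf_lower[OF _ bdd, of u] by (force simp: a_def A_def)
    then show "\<forall>\<^sub>F u in at_left a. \<P>(x in M. f x \<le> u) \<le> q"
      by (auto simp: eventually_at_filter)
  qed simp
  ultimately show ?thesis using mem_quantile_set_iff by blast
qed

text \<open>Once the distribution function exceeds \<open>q\<close> at some \<open>u0\<close>, every
  point beyond \<open>u0\<close> violates the second condition.\<close>

lemma quantile_set_bdd_above: "bdd_above (quantile_set M f q)"
proof -
  have "\<forall>\<^sub>F u in at_top. q < \<P>(x in M. f x \<le> u)"
    using tendsto_prob_le_at_top[OF f] q by (intro order_tendstoD) auto
  then obtain u0 where u0: "q < \<P>(x in M. f x \<le> u0)"
    by (auto simp: eventually_at_top_linorder)
  show ?thesis
  proof (rule bdd_aboveI)
    fix u assume "u \<in> quantile_set M f q"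
    then show "u \<le> u0"
      using u0 prob_le_le_prob_less[OF f, of u0 u]
      by (cases "u0 < u") (auto simp: mem_quantile_set_iff)
  qed
qed

lemma quantile_upper: "u \<in> quantile_set M f q \<Longrightarrow> u \<le> quantile M f q"
  unfolding quantile_eq_Sup by (rule cSup_upper[OF _ quantile_set_bdd_above])

lemma le_prob_le_quantile: "q \<le> \<P>(x in M. f x \<le> quantile M f q)"
proof -
  obtain v where "v \<in> quantile_set M f q" using quantile_set_nonempty by auto
  then show ?thesis
    using quantile_upper[of v] prob_le_mono[OF f, of v "quantile M f q"]
    by (auto simp: mem_quantile_set_iff)
qed

text \<open>Each \<open>u\<close> below the quantile has an element \<open>v\<close> of the set
  above it, which caps the distribution function at \<open>u\<close> by \<open>q\<close>; the cap
  passes to the left limit. With \<open>le_prob_le_quantile\<close> this shows that the supremum is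
  attained.\<close>

lemma prob_less_quantile_le: "\<P>(x in M. f x < quantile M f q) \<le> q"
proof (rule tendsto_upperbound[OF tendsto_prob_le_at_left[OF f]])
  have "\<P>(x in M. f x \<le> u) \<le> q" if uQ: "u < quantile M f q" for u
  proof -
    obtain v where "v \<in> quantile_set M f q" "u < v"
      using uQ less_cSupD[OF quantile_set_nonempty, of u] by (auto simp: quantile_eq_Sup)
    then show ?thesis
      using prob_le_le_prob_less[OF f, of u v] by (auto simp: mem_quantile_set_iff)
  qed
  then show "\<forall>\<^sub>F u in at_left (quantile M f q). \<P>(x in M. f x \<le> u) \<le> q"
    by (auto simp: eventually_at_filter)
qed simp

text \<open>By monotonicity the first condition persists above the quantile, so the second must fail
  there. The strict inequality is what makes the weight vanish at all levels above the
  quantile.\<close>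

lemma less_prob_less_of_quantile_less:
  assumes "quantile M f q < u"
  shows "q < \<P>(x in M. f x < u)"
proof (rule ccontr)
  assume "\<not> ?thesis"
  moreover have "q \<le> \<P>(x in M. f x \<le> u)"
    using le_prob_le_quantile prob_le_mono[OF f, of "quantile M f q" u] assms by simp
  ultimately have "u \<in> quantile_set M f q" by (simp add: mem_quantile_set_iff)
  with assms quantile_upper show False by fastforce
qed

text \<open>Continuity identifies the value at the quantile with the left limit there; the former is
  at least \<open>q\<close>, the latter at most \<open>q\<close>.\<close>

lemma prob_le_quantile_eq:
  assumes "isCont (\<lambda>u. \<P>(x in M. f x \<le> u)) (quantile M f q)"
  shows "\<P>(x in M. f x \<le> quantile M f q) = q"
proof -
  have "((\<lambda>u. \<P>(x in M. f x \<le> u)) \<longlongrightarrow> \<P>(x in M. f x \<le> quantile M f q)) (at_left (quantile M f q))"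
    using assms by (auto simp: isCont_def intro: filterlim_mono at_le)
  from tendsto_unique[OF _ this tendsto_prob_le_at_left[OF f]]
  show ?thesis using prob_less_quantile_le le_prob_le_quantile by simp
qed

lemma exists_ge_quantile: "\<exists>x\<in>space M. quantile M f q \<le> f x"
proof -
  have "0 < \<P>(x in M. quantile M f q \<le> f x)"
    using prob_less_quantile_le q by (simp add: prob_ge_eq)
  then show ?thesis
    by (metis (no_types, lifting) Collect_empty_eq less_irrefl measure_empty)
qed

section \<open>Bounding the preference function, and what the gain condition implies\<close>

lemma preference_le_indicator:
  assumes w: "\<And>u. u \<in> {0..1} \<Longrightarrow> w u = (if u \<le> q then 1 else 0)"
  shows "preference w M f x \<le> (if f x \<le> quantile M f q then 1 else 0)"
proof -
  let ?a = "q_less M f x" and ?b = "q_le M f x"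
  have ab: "0 \<le> ?a" "?a \<le> ?b" "?b \<le> 1"
    by (auto simp: q_less_def q_le_def intro!: finite_measure_mono)
  show ?thesis
  proof (cases "f x \<le> quantile M f q")
    case True
    \<comment> \<open>The comparison rule asks for integrability of the majorant only: a
      non-integrable left side would have the default integral 0, and the majorant is
      nonnegative.\<close>
    have "(LBINT u:{?a..?b}. w u) \<le> (LBINT u:{?a..?b}. 1)"
      unfolding set_lebesgue_integral_def
    proof (rule integral_mono')
      show "integrable lborel (\<lambda>u. indicat_real {?a..?b} u *\<^sub>R 1)"
        by (simp add: emeasure_lborel_Icc_eq)
    qed (use ab w in \<open>auto simp: indicator_def\<close>)
    also have "\<dots> = ?b - ?a" using ab by (simp add: set_lebesgue_integral_def)
    finally have "?a \<noteq> ?b \<Longrightarrow> (LBINT u:{?a..?b}. w u) / (?b - ?a) \<le> 1"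
      using ab by (simp add: divide_le_eq)
    then show ?thesis using True w[of ?b] ab by (auto simp: preference_def)
  next
    case False
    \<comment> \<open>Hence the whole interval of averaging, including its right end
      \<open>?b\<close>, lies where \<open>w\<close> is 0.\<close>
    then have "q < ?a"
      using less_prob_less_of_quantile_less[of "f x"] by (simp add: q_less_def)
    then have *: "w u = 0" if "u \<in> {?a..?b}" for u using that w[of u] ab by auto
    have "(LBINT u:{?a..?b}. w u) = (LBINT u:{?a..?b}. 0)"
      using * by (intro set_lebesgue_integral_cong) auto
    then show ?thesis
      using False *[of ?b] ab by (auto simp: preference_def set_lebesgue_integral_def)
  qed
qed

end

end

lemma weight_mass_indicator:
  assumes q: "q \<in> {0<..<1}"
    and w: "\<And>u. u \<in> {0..1} \<Longrightarrow> w u = (if u \<le> q then 1 else 0)"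
  shows "weight_mass w = q"
proof -
  have "weight_mass w = (\<integral>u. indicat_real {0..q} u \<partial>lborel)"
    unfolding weight_mass_def set_lebesgue_integral_def using q w
    by (intro Bochner_Integration.integral_cong) (auto simp: indicator_def)
  then show ?thesis using q by simp
qed

lemma J_le_prob_le_quantile:
  assumes "prob_space P" "prob_space P'"
    and f: "f \<in> borel_measurable P" and [measurable]: "f \<in> borel_measurable P'"
    and q: "q \<in> {0<..<1}"
    and w: "\<And>u. u \<in> {0..1} \<Longrightarrow> w u = (if u \<le> q then 1 else 0)"
  shows "J w f P' P \<le> \<P>(x in P'. f x \<le> quantile P f q)"
proof -
  interpret P: prob_space P by fact
  interpret P': prob_space P' by fact
  let ?A = "{x \<in> space P'. f x \<le> quantile P f q}"
  have "J w f P' P \<le> (\<integral>x. indicat_real ?A x \<partial>P')"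
    unfolding J_def
  proof (rule integral_mono')
    show "integrable P' (indicat_real ?A)" by (simp add: P'.emeasure_eq_measure)
    fix x assume "x \<in> space P'"
    then show "preference w P f x \<le> indicat_real ?A x"
      using P.preference_le_indicator[OF f q w, where x = x] by (auto simp: indicator_def)
  qed simp
  then show ?thesis by simp
qed

text \<open>The single form in which the gain condition enters both parts: on the right, the current
  distribution occurs only through its quantile.\<close>

lemma gain_condition_imp_le:
  assumes "prob_space P" "prob_space P'"
    and "f \<in> borel_measurable P" "f \<in> borel_measurable P'"
    and "q \<in> {0<..<1}"
    and "\<And>u. u \<in> {0..1} \<Longrightarrow> w u = (if u \<le> q then 1 else 0)"
    and "gain_condition w f q P P' \<Delta>"
  shows "exp \<Delta> * q \<le> \<P>(x in P'. f x \<le> quantile P f q)"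
  using J_le_prob_le_quantile[OF assms(1-6)] weight_mass_indicator[OF assms(5,6)] assms(7)
  by (auto simp: gain_condition_def)

section \<open>Global inversion on the range of \<open>f\<close>\<close>

lemma quantile_ge_inv_into:
  fixes f :: "'x \<Rightarrow> real" and P P' :: "'x measure"
  defines "F \<equiv> (\<lambda>u. \<P>(x in P'. f x \<le> u))" and "R \<equiv> f ` space P'"
  assumes P: "prob_space P" "prob_space P'" "space P = space P'"
    and f: "f \<in> borel_measurable P" "f \<in> borel_measurable P'"
    and q: "q \<in> {0<..<1}"
    and w: "\<And>u. u \<in> {0..1} \<Longrightarrow> w u = (if u \<le> q then 1 else 0)"
    and gain: "gain_condition w f q P P' \<Delta>"
    and cont: "continuous_on UNIV F" and strict: "strict_mono_on R F" and R: "is_interval R"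
  shows "exp \<Delta> * F (quantile P' f q) \<in> F ` R"
    and "inv_into R F (exp \<Delta> * F (quantile P' f q)) \<le> quantile P f q"
proof -
  interpret P: prob_space P by fact
  interpret P': prob_space P' by fact
  have mono: "F u \<le> F v" if "u \<le> v" for u v
    unfolding F_def using f(2) that by (rule P'.prob_le_mono)
  have "isCont F (quantile P' f q)"
    using cont continuous_on_eq_continuous_at open_UNIV by blast
  then have Fq: "F (quantile P' f q) = q"
    unfolding F_def by (rule P'.prob_le_quantile_eq[OF f(2) q])
  define c where "c = exp \<Delta> * q"
  have c: "0 < c" "c \<le> F (quantile P f q)"
    using q gain_condition_imp_le[OF P(1,2) f q w gain] by (auto simp: c_def F_def)
  \<comment> \<open>An event of positive probability is nonempty, so it supplies a value of
    \<open>f\<close>.\<close>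
  have R_below: "\<exists>r\<in>R. r \<le> u" if "0 < F u" for u
  proof (rule ccontr)
    assume "\<not> ?thesis"
    then have "{x \<in> space P'. f x \<le> u} = {}" by (auto simp: R_def)
    with that show False by (simp add: F_def)
  qed
  have "\<forall>\<^sub>F u in at_bot. F u < c"
    using P'.tendsto_prob_le_at_bot[OF f(2)] c(1) unfolding F_def by (intro order_tendstoD)
  then obtain u0 where u0: "F u0 < c"
    by (auto simp: eventually_at_bot_linorder)
  then have "u0 \<le> quantile P f q"
    using c(2) mono[of "quantile P f q" u0] by linarith
  \<comment> \<open>This \<open>u\<close> may lie outside \<open>R\<close>; since \<open>c\<close>
    is positive, \<open>R_below\<close> replaces it by a point \<open>r0\<close> of \<open>R\<close>
    on which \<open>F\<close> is at most \<open>c\<close>.\<close>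
  then obtain u where "F u = c"
    using IVT'[of F u0 c "quantile P f q"] u0 c(2) cont by (auto intro: continuous_on_subset)
  then obtain r0 where r0: "r0 \<in> R" "F r0 \<le> c"
    using R_below[of u] mono c(1) by auto
  obtain r1 where r1: "r1 \<in> R" "quantile P f q \<le> r1"
    using P.exists_ge_quantile[OF f(1) q] P(3) by (auto simp: R_def)
  with c(2) have "c \<le> F r1" using mono[of "quantile P f q" r1] by simp
  moreover have "connected (F ` R)"
    using R cont by (meson connected_continuous_image continuous_on_subset is_interval_connected subset_UNIV)
  ultimately have c_mem: "c \<in> F ` R"
    using r0 r1 by (meson connectedD_interval imageI)
  then obtain r where r: "r \<in> R" "F r = c" by auto
  \<comment> \<open>Strictness of \<open>F\<close> is known on \<open>R\<close> only. If
    \<open>r\<close> were larger, the quantile would lie between two points of the interval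
    \<open>R\<close>, hence in \<open>R\<close>, where strictness applies.\<close>
  have "r \<le> quantile P f q"
  proof (rule ccontr)
    assume less: "\<not> ?thesis"
    obtain r2 where "r2 \<in> R" "r2 \<le> quantile P f q"
      using R_below[of "quantile P f q"] c by auto
    with R r(1) less have "quantile P f q \<in> R"
      by (meson is_interval_1 le_cases)
    then have "F (quantile P f q) < F r"
      using strict r(1) less by (auto intro: strict_mono_onD)
    then show False using c(2) r(2) by simp
  qed
  moreover have "inv_into R F c = r"
    using r strict_mono_on_imp_inj_on[OF strict] by (auto intro: inv_into_f_eq)
  ultimately show "exp \<Delta> * F (quantile P' f q) \<in> F ` R"
    and "inv_into R F (exp \<Delta> * F (quantile P' f q)) \<le> quantile P f q"
    using c_mem by (simp_all add: Fq c_def)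
qed

section \<open>Local inversion and first-order expansion\<close>

text \<open>If \<open>v\<close> were below \<open>u\<close>, then \<open>F\<close> would be constant
  between them, including at points of \<open>U\<close> just left of \<open>u\<close>, against
  injectivity. The point \<open>v\<close> may lie outside \<open>U\<close>, as the quantile of a
  current distribution may.\<close>

lemma mono_inj_on_open_le:
  fixes F :: "real \<Rightarrow> real"
  assumes "mono F" "open U" "inj_on F U" "u \<in> U" "F u \<le> F v"
  shows "u \<le> v"
proof (rule ccontr)
  assume "\<not> u \<le> v"
  obtain e where e: "e > 0" "ball u e \<subseteq> U"
    using assms openE by blast
  define z where "z = max v (u - e / 2)"
  have "v \<le> z" "z < u" "z \<in> U"
    using e \<open>\<not> u \<le> v\<close> by (auto simp: z_def dist_real_def subset_iff max_def)
  moreover from this have "F z = F u"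
    using monoD[OF \<open>mono F\<close>, of v z] monoD[OF \<open>mono F\<close>, of z u] assms(5) by simp
  ultimately show False using assms(3,4) by (auto dest: inj_onD)
qed

text \<open>The inverse function theorem on the real line, stated for \<open>inv_into U F\<close>,
  which encodes the inverse of \<open>F\<close> near the quantile.\<close>

lemma DERIV_inv_into_strong:
  fixes F :: "real \<Rightarrow> real"
  assumes "open U" "x \<in> U" "continuous_on U F" "inj_on F U"
    and "(F has_real_derivative D) (at x)" "D \<noteq> 0"
  shows "(inv_into U F has_real_derivative inverse D) (at (F x))"
  unfolding has_field_derivative_def
proof (rule has_derivative_inverse_strong[where f = F and x = x and S = U and f' = "(*) D"])
  show "(F has_derivative (*) D) (at x)"
    using assms(5) by (simp add: has_field_derivative_def)
  show "(*) D \<circ> (*) (inverse D) = id"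
    using assms(6) by (auto simp: fun_eq_iff)
qed (use assms in auto)

text \<open>The epsilon-delta form of the derivative as a Landau statement. The filter
  \<open>nhds 0\<close> includes the point 0 itself, where the remainder is 0.\<close>

lemma DERIV_remainder_smallo:
  fixes h :: "real \<Rightarrow> real"
  assumes "(h has_real_derivative D) (at 0)"
  shows "(\<lambda>t. h t - h 0 - t * D) \<in> o[nhds 0](\<lambda>t. t)"
proof (rule landau_o.smallI)
  fix e :: real assume "e > 0"
  then obtain d where "d > 0" "\<And>t. norm (t - 0) < d \<Longrightarrow> norm (h t - h 0 - D * (t - 0)) \<le> e * norm (t - 0)"
    using assms unfolding has_field_derivative_def has_derivative_at_alt by blast
  then show "\<forall>\<^sub>F t in nhds 0. norm (h t - h 0 - t * D) \<le> e * norm t"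
    unfolding eventually_nhds_metric by (auto simp: dist_real_def mult.commute)
qed

lemma eventually_nhds_0_exp_mult:
  fixes q :: real
  assumes "open S" "q \<in> S"
  shows "\<forall>\<^sub>F \<Delta> in nhds 0. exp \<Delta> * q \<in> S"
proof -
  have "((\<lambda>\<Delta>. exp \<Delta> * q) \<longlongrightarrow> exp 0 * q) (nhds 0)"
    by (intro tendsto_intros filterlim_ident)
  with assms show ?thesis using topological_tendstoD by fastforce
qed

text \<open>In (b), the range of small \<Delta> for the second-order remainder may depend on both
  parameters. The first-order claim instead has one remainder and one neighbourhood of 0 serving all
  current parameters.\<close>

theorem proposition3:
  fixes m :: "'x measure"
    and f :: "'x \<Rightarrow> real"
    and \<Theta> :: "'t set"
    and p :: "'t \<Rightarrow> 'x \<Rightarrow> ennreal"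
    and P :: "'t \<Rightarrow> 'x measure"
    and w :: "real \<Rightarrow> real"
    and q :: real
    and \<theta> \<theta>' :: 't
    and F :: "real \<Rightarrow> real"
  assumes f: "f \<in> borel_measurable m"
    and p: "\<And>t. t \<in> \<Theta> \<Longrightarrow> p t \<in> borel_measurable m"
    and P: "\<And>t. t \<in> \<Theta> \<Longrightarrow> P t = density m (p t)"
    and prob: "\<And>t. t \<in> \<Theta> \<Longrightarrow> prob_space (P t)"
    and q: "q \<in> {0<..<1}"
    and w: "\<And>u. u \<in> {0..1} \<Longrightarrow> w u = (if u \<le> q then 1 else 0)"
    and \<theta>: "\<theta> \<in> \<Theta>" and \<theta>': "\<theta>' \<in> \<Theta>"
    and F: "F = (\<lambda>u. \<P>(x in P \<theta>'. f x \<le> u))"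
  shows
    \<comment> \<open>(a)\<close>
    "(\<forall>\<Delta>. gain_condition w f q (P \<theta>) (P \<theta>') \<Delta> \<longrightarrow>
       continuous_on UNIV F \<longrightarrow>
       strict_mono_on (f ` space m) F \<longrightarrow>
       is_interval (f ` space m) \<longrightarrow>
         exp \<Delta> * F (quantile (P \<theta>') f q) \<in> F ` (f ` space m) \<and>
         quantile (P \<theta>) f q \<ge>
           inv_into (f ` space m) F (exp \<Delta> * F (quantile (P \<theta>') f q))) \<and>
     \<comment> \<open>(b)\<close>
     (\<forall>U. open U \<longrightarrow> quantile (P \<theta>') f q \<in> U \<longrightarrow>
       bij_betw F U (F ` U) \<longrightarrow>
       F C1_differentiable_on U \<longrightarrow>
       deriv F (quantile (P \<theta>') f q) \<noteq> 0 \<longrightarrow>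
         inv_into U F differentiable (at q) \<and>
         deriv (inv_into U F) q > 0 \<and>
         (\<exists>r \<in> o[nhds 0](\<lambda>\<Delta>. \<Delta>\<^sup>2). \<forall>\<^sub>F \<Delta> in nhds 0.
            gain_condition w f q (P \<theta>) (P \<theta>') \<Delta> \<longrightarrow>
              quantile (P \<theta>) f q \<ge>
                quantile (P \<theta>') f q + q * \<Delta> * deriv (inv_into U F) q + r \<Delta>) \<and>
         \<comment> \<open>first-order remainder, uniform in the current parameter\<close>
         (\<exists>r \<in> o[nhds 0](\<lambda>\<Delta>. \<Delta>). \<forall>\<^sub>F \<Delta> in nhds 0. \<forall>t \<in> \<Theta>.
            gain_condition w f q (P t) (P \<theta>') \<Delta> \<longrightarrow>
              quantile (P t) f q \<ge>
                quantile (P \<theta>') f q + q * \<Delta> * deriv (inv_into U F) q + r \<Delta>))"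
proof -
  have mble: "f \<in> borel_measurable (P t)" and space: "space (P t) = space m" if "t \<in> \<Theta>" for t
    using f P[OF that] by simp_all
  interpret P': prob_space "P \<theta>'" by (rule prob[OF \<theta>'])
  note f' = mble[OF \<theta>']
  let ?Q' = "quantile (P \<theta>') f q"
  have gain: "exp \<Delta> * q \<le> F (quantile (P t) f q)"
    if "t \<in> \<Theta>" "gain_condition w f q (P t) (P \<theta>') \<Delta>" for t \<Delta>
    unfolding F using gain_condition_imp_le[OF prob[OF that(1)] prob[OF \<theta>'] mble[OF that(1)] f' q w that(2)] .
  have mono_F: "mono F"
    unfolding F by (intro monoI P'.prob_le_mono[OF f'])
  have a: "exp \<Delta> * F ?Q' \<in> F ` (f ` space m) \<and>
      inv_into (f ` space m) F (exp \<Delta> * F ?Q') \<le> quantile (P \<theta>) f q"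
    if "gain_condition w f q (P \<theta>) (P \<theta>') \<Delta>" "continuous_on UNIV F"
      "strict_mono_on (f ` space m) F" "is_interval (f ` space m)" for \<Delta>
    using quantile_ge_inv_into[OF prob[OF \<theta>] prob[OF \<theta>'] _ mble[OF \<theta>] f' q w that(1)] that(2-4)
    by (simp add: F space[OF \<theta>] space[OF \<theta>'])
  have b: "inv_into U F differentiable (at q) \<and>
      deriv (inv_into U F) q > 0 \<and>
      (\<exists>r \<in> o[nhds 0](\<lambda>\<Delta>. \<Delta>\<^sup>2). \<forall>\<^sub>F \<Delta> in nhds 0.
         gain_condition w f q (P \<theta>) (P \<theta>') \<Delta> \<longrightarrow>
           quantile (P \<theta>) f q \<ge> ?Q' + q * \<Delta> * deriv (inv_into U F) q + r \<Delta>) \<and>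
      (\<exists>r \<in> o[nhds 0](\<lambda>\<Delta>. \<Delta>). \<forall>\<^sub>F \<Delta> in nhds 0. \<forall>t \<in> \<Theta>.
         gain_condition w f q (P t) (P \<theta>') \<Delta> \<longrightarrow>
           quantile (P t) f q \<ge> ?Q' + q * \<Delta> * deriv (inv_into U F) q + r \<Delta>)"
    if U: "open U" "?Q' \<in> U" and bij: "bij_betw F U (F ` U)"
      and C1: "F C1_differentiable_on U" and nz: "deriv F ?Q' \<noteq> 0" for U
  proof -
    define G where "G = inv_into U F"
    define D where "D = deriv G q"
    have inj: "inj_on F U" using bij by (simp add: bij_betw_def)
    have cont: "continuous_on U F" using C1 by (rule C1_differentiable_imp_continuous_on)
    \<comment> \<open>Continuity at the quantile gives \<open>F ?Q' = q\<close>, so the local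
      inverse is differentiated exactly at \<open>q\<close>.\<close>
    have "isCont F ?Q'" using cont U by (simp add: continuous_on_eq_continuous_at)
    then have Fq: "F ?Q' = q"
      unfolding F by (rule P'.prob_le_quantile_eq[OF f' q])
    have le: "u \<le> v" if "u \<in> U" "F u \<le> F v" for u v
      using mono_inj_on_open_le[OF mono_F U(1) inj that] .
    have dF: "(F has_real_derivative deriv F ?Q') (at ?Q')"
      using C1 U(2) by (auto simp: C1_differentiable_on_eq DERIV_deriv_iff_real_differentiable)
    have dG: "(G has_real_derivative inverse (deriv F ?Q')) (at q)"
      using DERIV_inv_into_strong[OF U cont inj dF nz] by (simp add: Fq G_def)
    then have D: "D = inverse (deriv F ?Q')" unfolding D_def by (rule DERIV_imp_deriv)
    have "deriv F ?Q' \<ge> 0"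
      using mono_F dF by (intro mono_on_imp_deriv_nonneg[of UNIV F]) (auto simp: mono_on_def mono_def)
    with nz D have "D > 0" by simp
    have "\<forall>\<^sub>F \<Delta> in nhds 0. gain_condition w f q (P \<theta>) (P \<theta>') \<Delta> \<longrightarrow>
        ?Q' + q * \<Delta> * D + 0 \<le> quantile (P \<theta>) f q"
    proof (cases "quantile (P \<theta>) f q" ?Q' rule: linorder_cases)
      case less
      \<comment> \<open>Contrapositive of \<open>le\<close> at \<open>?Q'\<close>. As
        \<open>exp \<Delta> * q\<close> tends to \<open>q\<close>, it eventually exceeds this value,
        and the gain condition becomes false.\<close>
      then have "F (quantile (P \<theta>) f q) < q"
        using le[OF U(2), of "quantile (P \<theta>) f q"] Fq by (auto simp flip: not_le)
      then have "\<forall>\<^sub>F \<Delta> in nhds 0. exp \<Delta> * q \<in> {F (quantile (P \<theta>) f q)<..}"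
        by (intro eventually_nhds_0_exp_mult) auto
      then show ?thesis using gain[OF \<theta>] by (fastforce elim!: eventually_mono)
    next
      case equal
      have "q * \<Delta> * D \<le> 0" if "gain_condition w f q (P \<theta>) (P \<theta>') \<Delta>" for \<Delta>
      proof -
        have "\<Delta> \<le> 0" using gain[OF \<theta> that] q by (simp add: equal Fq)
        then show ?thesis using q \<open>D > 0\<close> by (simp add: mult_le_0_iff)
      qed
      then show ?thesis by (simp add: equal)
    next
      case greater
      have "((\<lambda>\<Delta>. ?Q' + q * \<Delta> * D + 0) \<longlongrightarrow> ?Q' + q * 0 * D + 0) (nhds 0)"
        by (intro tendsto_intros filterlim_ident)
      from order_tendstoD(2)[OF this, of "quantile (P \<theta>) f q"] greater show ?thesis
        by (auto elim!: eventually_mono)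
    qed
    then have second_order: "\<exists>r \<in> o[nhds 0](\<lambda>\<Delta>. \<Delta>\<^sup>2). \<forall>\<^sub>F \<Delta> in nhds 0.
        gain_condition w f q (P \<theta>) (P \<theta>') \<Delta> \<longrightarrow>
          ?Q' + q * \<Delta> * D + r \<Delta> \<le> quantile (P \<theta>) f q"
      by (intro bexI[of _ "\<lambda>_. 0"]) auto
    \<comment> \<open>Taylor remainder at 0 of the inverse along \<open>exp \<Delta> * q\<close>. It
      is built from the next distribution alone, hence uniform in \<open>t\<close>;
      \<open>exp 0\<close> is kept to match the shape \<open>h t - h 0 - t * D\<close>.\<close>
    define r where "r = (\<lambda>\<Delta>. G (exp \<Delta> * q) - G (exp 0 * q) - \<Delta> * (D * q))"
    have "((\<lambda>\<Delta>. G (exp \<Delta> * q)) has_real_derivative D * q) (at 0)"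
      using dG by (auto simp: D intro!: DERIV_chain'[where g = G] derivative_eq_intros)
    then have r: "r \<in> o[nhds 0](\<lambda>\<Delta>. \<Delta>)"
      unfolding r_def by (rule DERIV_remainder_smallo)
    \<comment> \<open>Openness keeps \<open>exp \<Delta> * q\<close> in the image for small
      \<Delta>, so that it has a preimage \<open>u\<close> in \<open>U\<close>.\<close>
    have "open (F ` U)" using cont U(1) inj by (rule invariance_of_domain)
    then have "\<forall>\<^sub>F \<Delta> in nhds 0. exp \<Delta> * q \<in> F ` U"
      using imageI[OF U(2), of F] by (intro eventually_nhds_0_exp_mult) (simp_all add: Fq)
    then have "\<forall>\<^sub>F \<Delta> in nhds 0. \<forall>t\<in>\<Theta>. gain_condition w f q (P t) (P \<theta>') \<Delta> \<longrightarrow>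
        ?Q' + q * \<Delta> * D + r \<Delta> \<le> quantile (P t) f q"
    proof eventually_elim
      case (elim \<Delta>)
      then obtain u where u: "u \<in> U" "F u = exp \<Delta> * q" by auto
      have "G (exp \<Delta> * q) = u" "G q = ?Q'"
        using inv_into_f_f[OF inj u(1)] inv_into_f_f[OF inj U(2)] by (simp_all add: G_def u(2) Fq)
      \<comment> \<open>By the choice of \<open>r\<close> the expansion is exact, so the bound
        reduces to comparing \<open>u\<close> with the current quantile through
        \<open>le\<close>.\<close>
      then have "?Q' + q * \<Delta> * D + r \<Delta> = u" by (simp add: r_def)
      then show ?case using le[OF u(1)] gain u(2) by simp
    qed
    with r have "\<exists>r \<in> o[nhds 0](\<lambda>\<Delta>. \<Delta>). \<forall>\<^sub>F \<Delta> in nhds 0. \<forall>t \<in> \<Theta>.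
        gain_condition w f q (P t) (P \<theta>') \<Delta> \<longrightarrow>
          ?Q' + q * \<Delta> * D + r \<Delta> \<le> quantile (P t) f q"
      by blast
    moreover have "G differentiable (at q)" using dG by (auto simp: real_differentiable_def)
    ultimately show ?thesis
      using second_order \<open>D > 0\<close> by (simp add: D_def G_def)
  qed
  from a b show ?thesis by blast
qed

end
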